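(* Let $f_1,\dots,f_T$ be base classifiers with values in $\{+1,-1\}$ and coefficients $\alpha_t>0$, $\sum_{t=1}^T\alpha_t=1$, let $\mathbf{x}_1,\dots,\mathbf{x}_N$ be the data points, and consider the noisy weighted-vote classifier described in the context, with base-classifier mismatch probabilities $p_1,\dots,p_T$. For $s>0$ put $$\widehat{p}_C(s)=\sum_{t=1}^{T}\left(e^{s\alpha_t}-1\right)p_t,\qquad \gamma_n=\left|\sum_{t=1}^{T}\alpha_t f_t(\mathbf{x}_n)\right|.$$ Then for every $s>0$ the mismatch probability $P_m$ satisfies $$P_m\le\left(\frac{1}{N}\sum_{n=1}^{N}\exp\left(-s\cdot\frac{\gamma_n}{2}\right)\right)\cdot\exp\left(\widehat{p}_C(s)\right).$$
   Context: Setting. The noise-free classifier is $f(\mathbf{x})=\operatorname{sign}\left(\sum_{t=1}^T\alpha_t f_t(\mathbf{x})\right)$, where $\operatorname{sign}$ takes values in $\{+1,-1\}$ (its value at $0$ is fixed by an arbitrary convention). At inference, each base classifier's output is randomly corrupted: for the data point $\mathbf{x}_n$, the output $f_t(\mathbf{x}_n)$ is replaced by a random $\widehat{f}_t(\mathbf{x}_n)\in\{+1,-1\}$. Let $\delta_{t,n}\in\{0,1\}$ be the indicator of the event $\widehat{f}_t(\mathbf{x}_n)\neq f_t(\mathbf{x}_n)$. For every $n$, $\mathbb{E}[\delta_{t,n}]=p_t$, where $p_t\in[0,1]$ is the mismatch probability of the $t$-th base classifier (it does not depend on $n$), and for each fixed $n$ the variables $\delta_{1,n},\dots,\delta_{T,n}$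 are independent. The noisy classifier is $\widehat{f}(\mathbf{x}_n)=\operatorname{sign}\left(\sum_{t=1}^T\alpha_t\widehat{f}_t(\mathbf{x}_n)\right)$. The mismatch probability of $\mathbf{x}_n$ is $P_m(\mathbf{x}_n)=\Pr(\widehat{f}(\mathbf{x}_n)\neq f(\mathbf{x}_n))$, the probability being over the noise. The mismatch probability is $P_m=\frac1N\sum_{n=1}^N P_m(\mathbf{x}_n)$ (the expectation over the input is the empirical mean over the data set). *)

theory Defs
  imports "HOL-Probability.Probability"
begin

text \<open>
  Classifier outputs are the reals \<open>1\<close> and \<open>-1\<close>. Base classifiers and data points are indexed by
  \<open>{1..T}\<close> and \<open>{1..N}\<close>. Unlike \<open>sgn\<close>, the function \<open>sign_conv z\<close> never takes the value \<open>0\<close> when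
  \<open>z\<close> is \<open>1\<close> or \<open>-1\<close>; the parameter \<open>z\<close> is the convention for the sign of \<open>0\<close>.
\<close>

definition sign_conv :: "real \<Rightarrow> real \<Rightarrow> real" where
  "sign_conv z r = (if r > 0 then 1 else if r < 0 then -1 else z)"

definition classifier ::
  "real \<Rightarrow> nat \<Rightarrow> (nat \<Rightarrow> real) \<Rightarrow> (nat \<Rightarrow> 'x \<Rightarrow> real) \<Rightarrow> 'x \<Rightarrow> real" where
  "classifier z T \<alpha> f y = sign_conv z (\<Sum>t=1..T. \<alpha> t * f t y)"

text \<open>
  \<open>fh t n\<close> is the random variable giving the noisy output of the \<open>t\<close>-th base classifier on the
  \<open>n\<close>-th data point. It is indexed by \<open>n\<close> rather than by the point itself, so that repeated data
  points may carry different noise.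
\<close>

definition noisy_classifier ::
  "real \<Rightarrow> nat \<Rightarrow> (nat \<Rightarrow> real) \<Rightarrow> (nat \<Rightarrow> nat \<Rightarrow> 'w \<Rightarrow> real) \<Rightarrow> nat \<Rightarrow> 'w \<Rightarrow> real" where
  "noisy_classifier z T \<alpha> fh n \<omega> = sign_conv z (\<Sum>t=1..T. \<alpha> t * fh t n \<omega>)"

definition mismatch_ind ::
  "(nat \<Rightarrow> 'x \<Rightarrow> real) \<Rightarrow> (nat \<Rightarrow> 'x) \<Rightarrow> (nat \<Rightarrow> nat \<Rightarrow> 'w \<Rightarrow> real) \<Rightarrow> nat \<Rightarrow> nat \<Rightarrow> 'w \<Rightarrow> real" where
  "mismatch_ind f x fh t n \<omega> = (if fh t n \<omega> \<noteq> f t (x n) then 1 else 0)"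

definition mismatch_prob_at ::
  "'w measure \<Rightarrow> real \<Rightarrow> nat \<Rightarrow> (nat \<Rightarrow> real) \<Rightarrow> (nat \<Rightarrow> 'x \<Rightarrow> real) \<Rightarrow> (nat \<Rightarrow> 'x) \<Rightarrow>
   (nat \<Rightarrow> nat \<Rightarrow> 'w \<Rightarrow> real) \<Rightarrow> nat \<Rightarrow> real" where
  "mismatch_prob_at M z T \<alpha> f x fh n =
     measure M {\<omega> \<in> space M. noisy_classifier z T \<alpha> fh n \<omega> \<noteq> classifier z T \<alpha> f (x n)}"

definition mismatch_prob ::
  "'w measure \<Rightarrow> real \<Rightarrow> nat \<Rightarrow> nat \<Rightarrow> (nat \<Rightarrow> real) \<Rightarrow> (nat \<Rightarrow> 'x \<Rightarrow> real) \<Rightarrow> (nat \<Rightarrow> 'x) \<Rightarrow>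
   (nat \<Rightarrow> nat \<Rightarrow> 'w \<Rightarrow> real) \<Rightarrow> real" where
  "mismatch_prob M z T N \<alpha> f x fh =
     (1 / real N) * (\<Sum>n=1..N. mismatch_prob_at M z T \<alpha> f x fh n)"

definition p_hat_C :: "nat \<Rightarrow> (nat \<Rightarrow> real) \<Rightarrow> (nat \<Rightarrow> real) \<Rightarrow> real \<Rightarrow> real" where
  "p_hat_C T \<alpha> p s = (\<Sum>t=1..T. (exp (s * \<alpha> t) - 1) * p t)"

definition margin ::
  "nat \<Rightarrow> (nat \<Rightarrow> real) \<Rightarrow> (nat \<Rightarrow> 'x \<Rightarrow> real) \<Rightarrow> (nat \<Rightarrow> 'x) \<Rightarrow> nat \<Rightarrow> real" where
  "margin T \<alpha> f x n = \<bar>\<Sum>t=1..T. \<alpha> t * f t (x n)\<bar>"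

end

theory Submission
  imports Defs
begin

text \<open>
  A vote can change sign only if the base classifiers that are flipped carry a total weight
  \<open>\<Sum>t. \<alpha> t * \<delta> t\<close> of at least half the margin, since flipping classifier \<open>t\<close> moves the vote by
  \<open>2 * \<alpha> t\<close>. Chernoff's bound for this weighted sum of independent Bernoulli variables, with
  \<open>1 + u \<le> exp u\<close> applied to each factor of its moment generating function, gives the estimate for
  each data point.
\<close>

text \<open>On \<open>{0, 1}\<close> the exponential agrees with its chord. This makes the moment
  generating function of a Bernoulli variable affine in its mean, so its expectation follows by
  linearity.\<close>

lemma exp_mult_binary:
  fixes a d :: real
  assumes "d \<in> {0, 1}"
  shows "exp (a * d) = 1 + (exp a - 1) * d"
  using assms by auto

context prob_space
begin

lemma integrable_binary:
  fixes X :: "'a \<Rightarrow> real"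
  assumes "random_variable borel X" and "\<And>\<omega>. X \<omega> \<in> {0, 1}"
  shows "integrable M X"
proof (rule integrable_const_bound[where B = 1])
  show "AE \<omega> in M. norm (X \<omega>) \<le> 1"
  proof (intro AE_I2)
    show "norm (X \<omega>) \<le> 1" for \<omega>
      using assms(2)[of \<omega>] by auto
  qed
qed (fact assms(1))

text \<open>Independence factors the moment generating function, and each factor depends on the law
  of \<open>X i\<close> only through \<open>p i\<close>. With \<open>I\<close> as
  \<open>{1..T}\<close> and \<open>c\<close> as half the margin, the second factor of the bound is
  \<open>exp (p_hat_C T \<alpha> p s)\<close>.\<close>

lemma Chernoff_weighted_binary_sum:
  fixes X :: "'i \<Rightarrow> 'a \<Rightarrow> real" and \<alpha> p :: "'i \<Rightarrow> real"
  assumes fin: "finite I"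
    and indep: "indep_vars (\<lambda>_. borel) X I"
    and bin: "\<And>i \<omega>. i \<in> I \<Longrightarrow> X i \<omega> \<in> {0, 1}"
    and mean: "\<And>i. i \<in> I \<Longrightarrow> expectation (X i) = p i"
    and s: "s > 0"
  shows "prob {\<omega> \<in> space M. (\<Sum>i\<in>I. \<alpha> i * X i \<omega>) \<ge> c}
           \<le> exp (- s * c) * exp (\<Sum>i\<in>I. (exp (s * \<alpha> i) - 1) * p i)"
proof -
  define Y where "Y = (\<lambda>i \<omega>. exp (s * \<alpha> i * X i \<omega>))"
  have intX: "integrable M (X i)" if "i \<in> I" for i
    using indep that bin[OF that] by (intro integrable_binary) (auto simp: indep_vars_def2)
  have Y_eq: "Y i = (\<lambda>\<omega>. 1 + (exp (s * \<alpha> i) - 1) * X i \<omega>)" if "i \<in> I" for i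
    unfolding Y_def using bin[OF that] by (intro ext exp_mult_binary)
  have intY: "integrable M (Y i)" if "i \<in> I" for i
    using intX[OF that] by (simp add: Y_eq[OF that])
  have meanY: "expectation (Y i) = 1 + (exp (s * \<alpha> i) - 1) * p i" if "i \<in> I" for i
    using intX[OF that] mean[OF that] by (simp add: Y_eq[OF that] prob_space)
  have indepY: "indep_vars (\<lambda>_. borel) Y I"
    unfolding Y_def by (rule indep_vars_compose2[OF indep]) simp
  have exp_sum_eq: "exp (s * (\<Sum>i\<in>I. \<alpha> i * X i \<omega>)) = (\<Prod>i\<in>I. Y i \<omega>)" for \<omega>
    by (simp add: Y_def sum_distrib_left mult.assoc exp_sum[OF fin])
  \<comment> \<open>Needed to compare the products factor by factor; each factor is the mean of the
    positive variable \<open>Y i\<close>.\<close>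
  have nonneg: "0 \<le> 1 + (exp (s * \<alpha> i) - 1) * p i" if "i \<in> I" for i
    unfolding meanY[OF that, symmetric] Y_def by (rule Bochner_Integration.integral_nonneg) simp
  have int: "integrable M (\<lambda>\<omega>. exp (s * (\<Sum>i\<in>I. \<alpha> i * X i \<omega>)))"
    unfolding exp_sum_eq by (rule indep_vars_integrable[OF fin indepY intY])
  have "prob {\<omega> \<in> space M. (\<Sum>i\<in>I. \<alpha> i * X i \<omega>) \<ge> c}
          \<le> exp (- s * c) * expectation (\<lambda>\<omega>. exp (s * (\<Sum>i\<in>I. \<alpha> i * X i \<omega>)))"
    \<comment> \<open>The library inequality concerns an integral over a set; taking that set to be
      \<open>space M\<close> recovers the plain expectation.\<close>
    using Chernoff_ineq_ge[OF s, of "space M" "\<lambda>\<omega>. \<Sum>i\<in>I. \<alpha> i * X i \<omega>" c]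
      integrable_mult_indicator[OF sets.top int]
    by (simp add: set_integrable_def set_lebesgue_integral_def cong: Bochner_Integration.integral_cong)
  also have "expectation (\<lambda>\<omega>. exp (s * (\<Sum>i\<in>I. \<alpha> i * X i \<omega>)))
      = (\<Prod>i\<in>I. 1 + (exp (s * \<alpha> i) - 1) * p i)"
    unfolding exp_sum_eq
    by (simp add: indep_vars_lebesgue_integral[OF fin indepY intY] meanY)
  also have "\<dots> \<le> (\<Prod>i\<in>I. exp ((exp (s * \<alpha> i) - 1) * p i))"
    by (intro prod_mono conjI nonneg exp_ge_add_one_self)
  also have "\<dots> = exp (\<Sum>i\<in>I. (exp (s * \<alpha> i) - 1) * p i)"
    by (rule exp_sum[OF fin, symmetric])
  finally show ?thesis
    by simp
qed

end

text \<open>If the signs differ, then \<open>0\<close> lies between \<open>a\<close> and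
  \<open>b\<close>, possibly at an endpoint, so \<open>b\<close> is at least as far from
  \<open>a\<close> as from \<open>0\<close>. This covers every convention \<open>z\<close>.\<close>

lemma sign_conv_neq_imp:
  assumes "sign_conv z a \<noteq> sign_conv z b"
  shows "\<bar>b\<bar> \<le> \<bar>b - a\<bar>"
  using assms by (auto simp: sign_conv_def split: if_splits)

text \<open>Stated for a single outcome, because the noisy outputs are known to be \<open>1\<close>
  or \<open>-1\<close> only on \<open>space M\<close>.\<close>

lemma mismatch_imp_half_margin_le:
  assumes f: "\<And>t. t \<in> {1..T} \<Longrightarrow> f t (x n) \<in> {1, -1}"
    and fh: "\<And>t. t \<in> {1..T} \<Longrightarrow> fh t n \<omega> \<in> {1, -1}"
    and \<alpha>: "\<And>t. t \<in> {1..T} \<Longrightarrow> \<alpha> t \<ge> 0"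
    and mismatch: "noisy_classifier z T \<alpha> fh n \<omega> \<noteq> classifier z T \<alpha> f (x n)"
  shows "margin T \<alpha> f x n / 2 \<le> (\<Sum>t=1..T. \<alpha> t * mismatch_ind f x fh t n \<omega>)"
proof -
  have "margin T \<alpha> f x n
      \<le> \<bar>(\<Sum>t=1..T. \<alpha> t * f t (x n)) - (\<Sum>t=1..T. \<alpha> t * fh t n \<omega>)\<bar>"
    using sign_conv_neq_imp mismatch
    unfolding margin_def noisy_classifier_def classifier_def by blast
  also have "\<dots> \<le> (\<Sum>t=1..T. \<bar>\<alpha> t * (f t (x n) - fh t n \<omega>)\<bar>)"
    by (simp add: sum_subtractf[symmetric] right_diff_distrib[symmetric])
  \<comment> \<open>The difference of two outputs is \<open>0\<close> or has absolute value
    \<open>2\<close>, and the weights are nonnegative, so each term is evaluated exactly.\<close>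
  also have "\<dots> = (\<Sum>t=1..T. 2 * (\<alpha> t * mismatch_ind f x fh t n \<omega>))"
    using f fh \<alpha> by (intro sum.cong refl) (fastforce simp: mismatch_ind_def abs_mult)
  finally show ?thesis
    by (simp add: sum_distrib_left[symmetric])
qed

theorem theorem2:
  fixes M :: "'w measure" and z s :: real and T N :: nat
    and \<alpha> p :: "nat \<Rightarrow> real"
    and f :: "nat \<Rightarrow> 'x \<Rightarrow> real" and x :: "nat \<Rightarrow> 'x"
    and fh :: "nat \<Rightarrow> nat \<Rightarrow> 'w \<Rightarrow> real"
  assumes "prob_space M"
    and "z \<in> {1, -1}"
    and "N \<ge> 1"
    and "\<And>t y. t \<in> {1..T} \<Longrightarrow> f t y \<in> {1, -1}"
    and "\<And>t. t \<in> {1..T} \<Longrightarrow> \<alpha> t > 0"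
    and "(\<Sum>t=1..T. \<alpha> t) = 1"
    and "\<And>t. t \<in> {1..T} \<Longrightarrow> 0 \<le> p t \<and> p t \<le> 1"
    and "\<And>t n. t \<in> {1..T} \<Longrightarrow> n \<in> {1..N} \<Longrightarrow> fh t n \<in> borel_measurable M"
    and "\<And>t n \<omega>. t \<in> {1..T} \<Longrightarrow> n \<in> {1..N} \<Longrightarrow> \<omega> \<in> space M \<Longrightarrow> fh t n \<omega> \<in> {1, -1}"
    and "\<And>t n. t \<in> {1..T} \<Longrightarrow> n \<in> {1..N} \<Longrightarrow>
           prob_space.expectation M (mismatch_ind f x fh t n) = p t"
    and "\<And>n. n \<in> {1..N} \<Longrightarrow>
           prob_space.indep_vars M (\<lambda>_. borel) (\<lambda>t. mismatch_ind f x fh t n) {1..T}"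
    and "s > 0"
  shows "mismatch_prob M z T N \<alpha> f x fh
           \<le> ((1 / real N) * (\<Sum>n=1..N. exp (- s * (margin T \<alpha> f x n / 2)))) * exp (p_hat_C T \<alpha> p s)"
proof -
  interpret prob_space M by fact
  have "mismatch_prob_at M z T \<alpha> f x fh n
      \<le> exp (- s * (margin T \<alpha> f x n / 2)) * exp (p_hat_C T \<alpha> p s)" if n: "n \<in> {1..N}" for n
  proof -
    have indep: "indep_vars (\<lambda>_. borel) (\<lambda>t. mismatch_ind f x fh t n) {1..T}"
      by (rule assms(11)[OF n])
    \<comment> \<open>Monotonicity of the measure asks that the larger event, defined through these
      indicators, be measurable.\<close>
    have [measurable]: "random_variable borel (mismatch_ind f x fh t n)" if "t \<in> {1..T}" for t
      using indep that by (auto simp: indep_vars_def2)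
    have "mismatch_prob_at M z T \<alpha> f x fh n
        \<le> prob {\<omega> \<in> space M. (\<Sum>t=1..T. \<alpha> t * mismatch_ind f x fh t n \<omega>) \<ge> margin T \<alpha> f x n / 2}"
      unfolding mismatch_prob_at_def
    proof (rule finite_measure_mono)
      show "{\<omega> \<in> space M. noisy_classifier z T \<alpha> fh n \<omega> \<noteq> classifier z T \<alpha> f (x n)}
          \<subseteq> {\<omega> \<in> space M. (\<Sum>t=1..T. \<alpha> t * mismatch_ind f x fh t n \<omega>) \<ge> margin T \<alpha> f x n / 2}"
        using assms(4,9) n less_imp_le[OF assms(5)]
        by (blast intro!: mismatch_imp_half_margin_le)
    qed measurable
    also have "\<dots> \<le> exp (- s * (margin T \<alpha> f x n / 2)) * exp (p_hat_C T \<alpha> p s)"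
      unfolding p_hat_C_def using n
      by (intro Chernoff_weighted_binary_sum indep assms) (auto simp: mismatch_ind_def)
    finally show ?thesis .
  qed
  \<comment> \<open>Since \<open>p t\<close> is the same for all data points, the factor
    \<open>exp (p_hat_C T \<alpha> p s)\<close> can be taken out of the sum.\<close>
  then have "(\<Sum>n=1..N. mismatch_prob_at M z T \<alpha> f x fh n)
      \<le> (\<Sum>n=1..N. exp (- s * (margin T \<alpha> f x n / 2))) * exp (p_hat_C T \<alpha> p s)"
    unfolding sum_distrib_right by (rule sum_mono)
  then show ?thesis
    unfolding mismatch_prob_def mult.assoc by (rule mult_left_mono) simp
qed

end
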